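(* Fix integers $k \ge 3$ and $i \in \{2, \dots, k-1\}$, and let $T$ be the tile $\{1,\dots,k\} \setminus \{i\} \subset \mathbb{Z}$. Then $T$ tiles $\mathbb{Z}^d$ for some $d$.
   Context: For $d \ge 1$, regard $T \subset \mathbb{Z}$ as a subset of $\mathbb{Z}^d$ via $x \mapsto (x,0,\dots,0)$. A copy of $T$ in $\mathbb{Z}^d$ is a subset of $\mathbb{Z}^d$ isometric to $T$ (Euclidean metric). $T$ tiles $\mathbb{Z}^d$ means $\mathbb{Z}^d$ can be partitioned into copies of $T$. *)

theory Defs
  imports Main "HOL.Real" "HOL.NthRoot"
begin

text \<open>Points of Z^d are integer lists of length d (d varies inside the statement).\<close>

definition lattice :: "nat \<Rightarrow> int list set" where
  "lattice d = {x. length x = d}"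

definition edist :: "int list \<Rightarrow> int list \<Rightarrow> real" where
  "edist x y = sqrt (\<Sum>j<length x. (real_of_int (x ! j - y ! j))^2)"

text \<open>Embedding of Z into Z^d via x |-> (x,0,...,0) (for d >= 1).\<close>
definition embed :: "nat \<Rightarrow> int \<Rightarrow> int list" where
  "embed d x = x # replicate (d - 1) 0"

definition is_copy :: "nat \<Rightarrow> int set \<Rightarrow> int list set \<Rightarrow> bool" where
  "is_copy d T S \<longleftrightarrow> S \<subseteq> lattice d \<and>
     (\<exists>f. bij_betw f (embed d ` T) S \<and>
          (\<forall>x\<in>embed d ` T. \<forall>y\<in>embed d ` T. edist (f x) (f y) = edist x y))"

definition tiles :: "int set \<Rightarrow> nat \<Rightarrow> bool" where
  "tiles T d \<longleftrightarrow> (\<exists>P. (\<forall>S\<in>P. is_copy d T S) \<and>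
      (\<forall>S\<in>P. \<forall>S'\<in>P. S \<noteq> S' \<longrightarrow> S \<inter> S' = {}) \<and>
      \<Union>P = lattice d)"

end

theory Submission
  imports Defs
begin

text \<open>
  Let T be the punctured interval. Translates of T by multiples of k cover a line except one
  residue class, so a set of holes in the torus of vectors modulo k is \<^emph>\<open>fillable\<close> if its
  complement splits into axis-parallel lines with one point removed. Single points are fillable.
  Stacking k fillable sets as the slices of a torus of one more dimension gives a fillable set, so
  there are fillable sets of every size congruent to 1 modulo k - 1. If S is fillable, so is the
  graph of any map from S to another torus: fill the complement of S in every slice, and over each
  point of S fill everything but one point. Hence, taking the product of one embedding per subset,
  any finite set P embeds into a torus so that every subset of P of size congruent to 1 modulo
  k - 1 becomes fillable.

  Since both end points of T have coefficient 1, a two-sided linear recursion gives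
  weights w(a) in {0, ..., k - 2} for all integers a such that for every y the sum of w(y - t)
  over t in T is 1 modulo k - 1. In Z x Z^d, place w(a) copies of a + T in the first direction,
  over different points of the embedded P, using P-points indexed by a mod k so that copies over the
  same point are disjoint. The number of points covered in every slice {y} x Z^d is then
  1 modulo k - 1, so the rest of the slice can be filled.
\<close>

section \<open>Axis-parallel copies and tilings by them\<close>

text \<open>The free prefix \<open>u\<close> and suffix \<open>w\<close>, with no dimension fixed,
  keep the notion stable under appending coordinates on either side. This replaces all reasoning
  about isometries.\<close>

definition axis_copy :: "int set \<Rightarrow> int list set \<Rightarrow> bool" where
  "axis_copy T S \<longleftrightarrow> (\<exists>u c w. S = (\<lambda>t. u @ (c + t) # w) ` T)"

definition axis_tileable :: "int set \<Rightarrow> int list set \<Rightarrow> bool" where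
  "axis_tileable T A \<longleftrightarrow> (\<exists>P. (\<forall>S\<in>P. axis_copy T S) \<and> pairwise disjnt P \<and> \<Union>P = A)"

lemma edist_axis: "edist (u @ a # w) (u @ b # w) = \<bar>real_of_int (a - b)\<bar>"
proof -
  have "(\<Sum>j<length (u @ a # w). (real_of_int ((u @ a # w) ! j - (u @ b # w) ! j))\<^sup>2)
      = (\<Sum>j<length (u @ a # w). if j = length u then (real_of_int (a - b))\<^sup>2 else 0)"
    by (rule sum.cong) (auto simp: nth_append nth_Cons')
  also have "\<dots> = (real_of_int (a - b))\<^sup>2"
    by (subst sum.delta) auto
  finally show ?thesis
    unfolding edist_def by (simp only: real_sqrt_abs)
qed

lemma axis_copy_is_copy:
  assumes "axis_copy T S" "S \<subseteq> lattice d"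
  shows "is_copy d T S"
proof -
  obtain u c w where S: "S = (\<lambda>t. u @ (c + t) # w) ` T"
    using assms(1) unfolding axis_copy_def by blast
  define f where "f = (\<lambda>x. u @ (c + hd x) # w)"
  have f_embed: "f (embed d t) = u @ (c + t) # w" for t
    by (simp add: f_def embed_def)
  have "inj_on f (embed d ` T)"
    by (auto simp: inj_on_def f_embed)
  moreover have "f ` embed d ` T = S"
    by (simp add: S image_image f_embed)
  moreover have "edist (f (embed d s)) (f (embed d t)) = edist (embed d s) (embed d t)" for s t
    unfolding f_embed edist_axis using edist_axis[of "[]" s _ t] by (simp add: embed_def)
  ultimately show ?thesis
    using assms(2) unfolding is_copy_def bij_betw_def by auto
qed

lemma axis_tileable_imp_tiles:
  assumes "axis_tileable T (lattice d)"
  shows "tiles T d"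
proof -
  obtain P where P: "\<forall>S\<in>P. axis_copy T S" "pairwise disjnt P" "\<Union>P = lattice d"
    using assms unfolding axis_tileable_def by blast
  have "is_copy d T S" if "S \<in> P" for S
    using P that by (intro axis_copy_is_copy) auto
  moreover have "\<forall>S\<in>P. \<forall>S'\<in>P. S \<noteq> S' \<longrightarrow> S \<inter> S' = {}"
    using P(2) by (simp add: pairwise_def disjnt_def)
  ultimately show ?thesis
    unfolding tiles_def using P(3) by (intro exI[of _ P]) simp
qed

lemma axis_tileable_UN:
  assumes "\<And>x. x \<in> I \<Longrightarrow> axis_tileable T (A x)"
    and "\<And>x y. x \<in> I \<Longrightarrow> y \<in> I \<Longrightarrow> x \<noteq> y \<Longrightarrow> A x \<inter> A y = {}"
  shows "axis_tileable T (\<Union>x\<in>I. A x)"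
proof -
  have "\<forall>x\<in>I. \<exists>P. (\<forall>S\<in>P. axis_copy T S) \<and> pairwise disjnt P \<and> \<Union>P = A x"
    using assms(1) unfolding axis_tileable_def by blast
  then obtain P where P: "\<forall>x\<in>I. (\<forall>S\<in>P x. axis_copy T S) \<and> pairwise disjnt (P x) \<and> \<Union>(P x) = A x"
    by (rule bchoice[THEN exE])
  have copies: "\<forall>S\<in>(\<Union>x\<in>I. P x). axis_copy T S"
    using P by blast
  have Union: "\<Union>(P x) = A x" if "x \<in> I" for x
    using P that by simp
  have "disjnt S S'" if S: "x \<in> I" "S \<in> P x" and S': "y \<in> I" "S' \<in> P y" and "S \<noteq> S'" for x y S S'
  proof (cases "x = y")
    case True
    have "pairwise disjnt (P x)" using P S(1) by simp
    then show ?thesis using True S S' \<open>S \<noteq> S'\<close> by (auto simp: pairwise_def)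
  next
    case False
    have "S \<subseteq> A x" "S' \<subseteq> A y"
      using Union[OF S(1)] Union[OF S'(1)] S(2) S'(2) by auto
    with assms(2)[OF S(1) S'(1) False] show ?thesis
      unfolding disjnt_def by blast
  qed
  then have "pairwise disjnt (\<Union>x\<in>I. P x)"
    by (auto simp: pairwise_def)
  moreover have "\<Union>(\<Union>x\<in>I. P x) = (\<Union>x\<in>I. \<Union>(P x))"
    by blast
  then have "\<Union>(\<Union>x\<in>I. P x) = (\<Union>x\<in>I. A x)"
    using Union by simp
  ultimately show ?thesis
    unfolding axis_tileable_def using copies by (intro exI[of _ "\<Union>x\<in>I. P x"]) simp
qed

lemma axis_tileable_Un:
  assumes "axis_tileable T A" "axis_tileable T B" "A \<inter> B = {}"
  shows "axis_tileable T (A \<union> B)"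
proof -
  have "axis_tileable T (\<Union>b\<in>UNIV. if b then A else B)"
    using assms by (intro axis_tileable_UN) auto
  then show ?thesis
    by (simp add: UNIV_bool Un_commute)
qed

lemma axis_tileable_empty: "axis_tileable T {}"
  unfolding axis_tileable_def by (intro exI[of _ "{}"]) auto

lemma axis_tileable_image:
  assumes "axis_tileable T A" "inj f" "\<And>S. axis_copy T S \<Longrightarrow> axis_copy T (f ` S)"
  shows "axis_tileable T (f ` A)"
proof -
  obtain P where P: "\<forall>S\<in>P. axis_copy T S" "pairwise disjnt P" "\<Union>P = A"
    using assms(1) unfolding axis_tileable_def by blast
  have "pairwise disjnt ((`) f ` P)"
    using P(2) assms(2) unfolding pairwise_def disjnt_def
    by (auto simp: image_Int[symmetric])
  moreover have "\<Union>((`) f ` P) = f ` A"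
    using P(3) by blast
  ultimately show ?thesis
    unfolding axis_tileable_def using P(1) assms(3) by (intro exI[of _ "(`) f ` P"]) auto
qed

lemma axis_tileable_append_left:
  assumes "axis_tileable T A"
  shows "axis_tileable T ((@) u ` A)"
proof (rule axis_tileable_image[OF assms])
  fix S assume "axis_copy T S"
  then obtain u' c w where "S = (\<lambda>t. u' @ (c + t) # w) ` T"
    unfolding axis_copy_def by blast
  then have "(@) u ` S = (\<lambda>t. (u @ u') @ (c + t) # w) ` T"
    by (simp add: image_image)
  then show "axis_copy T ((@) u ` S)"
    unfolding axis_copy_def by blast
qed (simp add: inj_def)

lemma axis_tileable_append_right:
  assumes "axis_tileable T A"
  shows "axis_tileable T ((\<lambda>v. v @ w) ` A)"
proof (rule axis_tileable_image[OF assms])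
  fix S assume "axis_copy T S"
  then obtain u c w' where "S = (\<lambda>t. u @ (c + t) # w') ` T"
    unfolding axis_copy_def by blast
  then have "(\<lambda>v. v @ w) ` S = (\<lambda>t. u @ (c + t) # (w' @ w)) ` T"
    by (simp add: image_image)
  then show "axis_copy T ((\<lambda>v. v @ w) ` S)"
    unfolding axis_copy_def by blast
qed (simp add: inj_def)

lemma axis_tileable_translates:
  assumes "\<And>a b. a \<in> C \<Longrightarrow> b \<in> C \<Longrightarrow> a \<noteq> b \<Longrightarrow> (+) a ` T \<inter> (+) b ` T = {}"
  shows "axis_tileable T ((\<lambda>y. [y]) ` (\<Union>a\<in>C. (+) a ` T))"
proof -
  have copy: "axis_tileable T ((\<lambda>y. [y]) ` (+) a ` T)" for a
  proof -
    have "axis_copy T ((\<lambda>y. [y]) ` (+) a ` T)"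
      unfolding axis_copy_def
      by (intro exI[of _ "[]"] exI[of _ a]) (simp add: image_image)
    then show ?thesis
      unfolding axis_tileable_def by (intro exI[of _ "{(\<lambda>y. [y]) ` (+) a ` T}"]) auto
  qed
  have "axis_tileable T (\<Union>a\<in>C. (\<lambda>y. [y]) ` (+) a ` T)"
  proof (rule axis_tileable_UN[OF copy])
    fix a b assume "a \<in> C" "b \<in> C" "a \<noteq> b"
    then have "(+) a ` T \<inter> (+) b ` T = {}" by (rule assms)
    then show "(\<lambda>y. [y]) ` (+) a ` T \<inter> (\<lambda>y. [y]) ` (+) b ` T = {}" by auto
  qed
  then show ?thesis by (simp add: image_UN)
qed

section \<open>Complements of periodic hole sets: graphs and slices\<close>

definition residue_vectors :: "int \<Rightarrow> nat \<Rightarrow> int list set" where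
  "residue_vectors k d = {s. length s = d \<and> set s \<subseteq> {0..<k}}"

text \<open>The hole set lives in the torus modulo \<open>k\<close>, but its periodic preimage is
  removed from the lattice, so that a filling is already a tiling of part of Z^d.\<close>

definition avoiding :: "int \<Rightarrow> nat \<Rightarrow> int list set \<Rightarrow> int list set" where
  "avoiding k d S = {v \<in> lattice d. map (\<lambda>y. y mod k) v \<notin> S}"

lemma residue_vectors_Cons:
  "x # s \<in> residue_vectors k (Suc d) \<longleftrightarrow> x \<in> {0..<k} \<and> s \<in> residue_vectors k d"
  by (auto simp: residue_vectors_def)

lemma residue_vectors_append:
  "s \<in> residue_vectors k d \<Longrightarrow> t \<in> residue_vectors k e \<Longrightarrow> s @ t \<in> residue_vectors k (d + e)"
  by (auto simp: residue_vectors_def)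

text \<open>For each fixed \<open>w\<close> the filling of the complement of \<open>S\<close> is
  copied, which covers every fibre over a point not reducing into \<open>S\<close>. Each remaining
  fibre is filled except for the class \<open>h s\<close>, and what is left is the graph of
  \<open>h\<close>.\<close>

lemma axis_tileable_graph_right:
  assumes "axis_tileable T (avoiding k d S)"
    and "\<And>s. s \<in> S \<Longrightarrow> length s = d"
    and "\<And>s. s \<in> S \<Longrightarrow> length (h s) = e"
    and "\<And>s. s \<in> S \<Longrightarrow> axis_tileable T (avoiding k e {h s})"
  shows "axis_tileable T (avoiding k (d + e) ((\<lambda>s. s @ h s) ` S))"
proof -
  let ?m = "map (\<lambda>y. y mod k)"
  let ?A = "\<Union>w\<in>lattice e. (\<lambda>v. v @ w) ` avoiding k d S"
  let ?B = "\<Union>v\<in>{v \<in> lattice d. ?m v \<in> S}. (@) v ` avoiding k e {h (?m v)}"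
  have tile_A: "axis_tileable T ?A"
    by (intro axis_tileable_UN axis_tileable_append_right assms(1))
      (auto simp: avoiding_def lattice_def)
  have tile_B: "axis_tileable T ?B"
    by (intro axis_tileable_UN axis_tileable_append_left assms(4))
      (auto simp: avoiding_def lattice_def)
  \<comment> \<open>Whether the first block reduces into \<open>S\<close> separates the two
    families.\<close>
  have A: "x \<in> lattice (d + e) \<and> ?m (take d x) \<notin> S" if "x \<in> ?A" for x
    using that by (auto simp: avoiding_def lattice_def)
  have B: "x \<in> lattice (d + e) \<and> ?m (take d x) \<in> S \<and> ?m (drop d x) \<noteq> h (?m (take d x))"
    if "x \<in> ?B" for x
    using that by (auto simp: avoiding_def lattice_def)
  have "?A \<inter> ?B = {}"
    using A B by blast
  then have "axis_tileable T (?A \<union> ?B)"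
    by (rule axis_tileable_Un[OF tile_A tile_B])
  also have "?A \<union> ?B = avoiding k (d + e) ((\<lambda>s. s @ h s) ` S)" (is "_ = ?R")
  proof
    show "?A \<union> ?B \<subseteq> ?R"
    proof
      fix x assume x: "x \<in> ?A \<union> ?B"
      have "?m x \<noteq> s @ h s" if "s \<in> S" for s
      proof
        assume "?m x = s @ h s"
        then have "?m (take d x) = s" "?m (drop d x) = h s"
          using assms(2,3) that by (simp_all add: take_map[symmetric] drop_map[symmetric])
        with A[of x] B[of x] x that show False by blast
      qed
      moreover have "x \<in> lattice (d + e)"
        using A[of x] B[of x] x by (auto simp: add.commute)
      ultimately show "x \<in> ?R"
        by (auto simp: avoiding_def)
    qed
    show "?R \<subseteq> ?A \<union> ?B"
    proof
      fix x assume x: "x \<in> ?R"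
      define v w where "v = take d x" and "w = drop d x"
      have vw: "x = v @ w" "length v = d" "length w = e"
        using x by (auto simp: v_def w_def avoiding_def lattice_def)
      show "x \<in> ?A \<union> ?B"
      proof (cases "?m v \<in> S")
        case True
        with x vw have "?m w \<noteq> h (?m v)"
          by (auto simp: avoiding_def)
        with True vw show ?thesis
          by (intro UnI2 UN_I[of v]) (auto simp: avoiding_def lattice_def)
      next
        case False
        with vw show ?thesis
          by (intro UnI1 UN_I[of w]) (auto simp: avoiding_def lattice_def)
      qed
    qed
  qed
  finally show ?thesis .
qed

text \<open>Mirror image of \<open>axis_tileable_graph_right\<close>. Both sides are needed because
  a set of concatenated vectors is later viewed as a graph over either of its two blocks.\<close>

lemma axis_tileable_graph_left:
  assumes "axis_tileable T (avoiding k d S)"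
    and "\<And>s. s \<in> S \<Longrightarrow> length s = d"
    and "\<And>s. s \<in> S \<Longrightarrow> length (h s) = e"
    and "\<And>s. s \<in> S \<Longrightarrow> axis_tileable T (avoiding k e {h s})"
  shows "axis_tileable T (avoiding k (e + d) ((\<lambda>s. h s @ s) ` S))"
proof -
  let ?m = "map (\<lambda>y. y mod k)"
  let ?A = "\<Union>w\<in>lattice e. (@) w ` avoiding k d S"
  let ?B = "\<Union>v\<in>{v \<in> lattice d. ?m v \<in> S}. (\<lambda>w. w @ v) ` avoiding k e {h (?m v)}"
  have tile_A: "axis_tileable T ?A"
    by (intro axis_tileable_UN axis_tileable_append_left assms(1))
      (auto simp: avoiding_def lattice_def)
  have tile_B: "axis_tileable T ?B"
    by (intro axis_tileable_UN axis_tileable_append_right assms(4))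
      (auto simp: avoiding_def lattice_def)
  have A: "x \<in> lattice (d + e) \<and> ?m (drop e x) \<notin> S" if "x \<in> ?A" for x
    using that by (auto simp: avoiding_def lattice_def)
  have B: "x \<in> lattice (d + e) \<and> ?m (drop e x) \<in> S \<and> ?m (take e x) \<noteq> h (?m (drop e x))"
    if "x \<in> ?B" for x
    using that by (auto simp: avoiding_def lattice_def)
  have "?A \<inter> ?B = {}"
    using A B by blast
  then have "axis_tileable T (?A \<union> ?B)"
    by (rule axis_tileable_Un[OF tile_A tile_B])
  also have "?A \<union> ?B = avoiding k (e + d) ((\<lambda>s. h s @ s) ` S)" (is "_ = ?R")
  proof
    show "?A \<union> ?B \<subseteq> ?R"
    proof
      fix x assume x: "x \<in> ?A \<union> ?B"
      have "?m x \<noteq> h s @ s" if "s \<in> S" for s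
      proof
        assume "?m x = h s @ s"
        then have "?m (drop e x) = s" "?m (take e x) = h s"
          using assms(2,3) that by (simp_all add: take_map[symmetric] drop_map[symmetric])
        with A[of x] B[of x] x that show False by blast
      qed
      moreover have "x \<in> lattice (e + d)"
        using A[of x] B[of x] x by (auto simp: add.commute)
      ultimately show "x \<in> ?R"
        by (auto simp: avoiding_def)
    qed
    show "?R \<subseteq> ?A \<union> ?B"
    proof
      fix x assume x: "x \<in> ?R"
      define w v where "w = take e x" and "v = drop e x"
      have vw: "x = w @ v" "length v = d" "length w = e"
        using x by (auto simp: v_def w_def avoiding_def lattice_def)
      show "x \<in> ?A \<union> ?B"
      proof (cases "?m v \<in> S")
        case True
        with x vw have "?m w \<noteq> h (?m v)"
          by (auto simp: avoiding_def)
        with True vw show ?thesis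
          by (intro UnI2 UN_I[of v]) (auto simp: avoiding_def lattice_def)
      next
        case False
        with vw show ?thesis
          by (intro UnI1 UN_I[of w]) (auto simp: avoiding_def lattice_def)
      qed
    qed
  qed
  finally show ?thesis .
qed

text \<open>Slices are disjoint, so their fillings can be chosen independently; letting the choice
  depend on \<open>y mod k\<close> makes the holes periodic in the new direction too.\<close>

lemma axis_tileable_slices:
  assumes "k > 0" and "\<And>x. x \<in> {0..<k} \<Longrightarrow> axis_tileable T (avoiding k d (S x))"
  shows "axis_tileable T (avoiding k (Suc d) (\<Union>x\<in>{0..<k}. (#) x ` S x))"
proof -
  have "axis_tileable T (\<Union>y\<in>UNIV. (@) [y] ` avoiding k d (S (y mod k)))"
    using assms(1) by (intro axis_tileable_UN axis_tileable_append_left assms(2)) auto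
  also have "(\<Union>y\<in>UNIV. (@) [y] ` avoiding k d (S (y mod k)))
      = avoiding k (Suc d) (\<Union>x\<in>{0..<k}. (#) x ` S x)"
    using assms(1) by (auto simp: avoiding_def lattice_def image_iff length_Suc_conv)
  finally show ?thesis .
qed

section \<open>Fillable hole sets for the punctured interval\<close>

locale punctured_interval =
  fixes k i :: int
  assumes k: "k \<ge> 3" and i: "2 \<le> i" "i \<le> k - 1"
begin

definition T :: "int set" where "T = {1..k} - {i}"

abbreviation fillable :: "nat \<Rightarrow> int list set \<Rightarrow> bool" where
  "fillable d S \<equiv> axis_tileable T (avoiding k d S)"

text \<open>Two elements of \<open>T\<close> differ by less than \<open>k\<close>, whereas the
  shifts differ by a nonzero multiple of \<open>k\<close>.\<close>

lemma translates_disjoint: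
  assumes "a mod k = b mod k" "a \<noteq> b"
  shows "(+) a ` T \<inter> (+) b ` T = {}"
proof -
  have "s - t \<noteq> b - a" if "s \<in> T" "t \<in> T" for s t
  proof
    assume eq: "s - t = b - a"
    have "k dvd b - a"
      using assms(1) by (simp add: mod_eq_dvd_iff[symmetric])
    with eq have "k dvd s - t" by simp
    moreover have "\<bar>s - t\<bar> < k"
      using that by (auto simp: T_def)
    ultimately have "s - t = 0"
      using zdvd_not_zless[of "\<bar>s - t\<bar>" k] by (cases "s = t") auto
    with eq assms(2) show False by simp
  qed
  then show ?thesis by (force simp: algebra_simps)
qed

text \<open>Shifts congruent to \<open>x - i\<close> put the puncture of \<open>T\<close> on the
  class of \<open>x\<close>, and the other elements of \<open>T\<close> reach all other
  classes.\<close>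

lemma fillable_singleton_1:
  assumes "0 \<le> x" "x < k"
  shows "fillable 1 {[x]}"
proof -
  let ?C = "{a. a mod k = (x - i) mod k}"
  have "axis_tileable T ((\<lambda>y. [y]) ` (\<Union>a\<in>?C. (+) a ` T))"
    by (intro axis_tileable_translates translates_disjoint) auto
  also have "(\<Union>a\<in>?C. (+) a ` T) = {y. y mod k \<noteq> x}"
  proof (intro equalityI subsetI)
    fix y assume "y \<in> (\<Union>a\<in>?C. (+) a ` T)"
    then obtain a t where at: "a mod k = (x - i) mod k" "t \<in> T" "y = a + t" by blast
    have "y mod k \<noteq> x"
    proof
      assume "y mod k = x"
      then have "k dvd y - x"
        using assms by (metis mod_eq_dvd_iff mod_mod_trivial)
      moreover have "k dvd a - (x - i)"
        using at(1) by (simp add: mod_eq_dvd_iff)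
      ultimately have "k dvd (y - x) - (a - (x - i))" by (rule dvd_diff)
      then have "k dvd t - i" using at(3) by simp
      moreover have "\<bar>t - i\<bar> < k" "t \<noteq> i"
        using at(2) i by (auto simp: T_def)
      ultimately show False
        using zdvd_not_zless[of "\<bar>t - i\<bar>" k] by auto
    qed
    then show "y \<in> {y. y mod k \<noteq> x}" by simp
  next
    fix y assume "y \<in> {y. y mod k \<noteq> x}"
    then have y: "y mod k \<noteq> x" by simp
    \<comment> \<open>The representative of \<open>y - x + i\<close> in {1..k}; the shift by 1 is
      there because \<open>T\<close> starts at 1.\<close>
    define t where "t = (y - x + i - 1) mod k + 1"
    have "0 \<le> (y - x + i - 1) mod k" "(y - x + i - 1) mod k < k"
      using k by auto
    then have t: "1 \<le> t" "t \<le> k" by (auto simp: t_def)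
    have "y - t - (x - i) = (y - x + i - 1) - (y - x + i - 1) mod k"
      by (simp add: t_def)
    then have d: "k dvd y - t - (x - i)"
      by (simp only: dvd_minus_mod)
    have "t \<noteq> i"
    proof
      assume "t = i"
      with d have "k dvd y - x" by simp
      then have "y mod k = x mod k" by (simp add: mod_eq_dvd_iff)
      with y assms show False by simp
    qed
    with t have "t \<in> T" by (auto simp: T_def)
    moreover have "y - t \<in> ?C" using d by (simp add: mod_eq_dvd_iff)
    ultimately show "y \<in> (\<Union>a\<in>?C. (+) a ` T)"
      by (intro UN_I[of "y - t"]) (auto simp: image_iff)
  qed
  also have "(\<lambda>y. [y]) ` {y. y mod k \<noteq> x} = avoiding k 1 {[x]}"
    by (auto simp: avoiding_def lattice_def length_Suc_conv)
  finally show ?thesis .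
qed

text \<open>A point is the graph of a map on a one-point set, so coordinates can be added one at a
  time. In dimension 0 nothing remains to be filled.\<close>

lemma fillable_singleton:
  "s \<in> residue_vectors k d \<Longrightarrow> fillable d {s}"
proof (induction d arbitrary: s)
  case 0
  then have "avoiding k 0 {s} = {}"
    by (auto simp: avoiding_def lattice_def residue_vectors_def)
  then show ?case by (simp add: axis_tileable_empty)
next
  case (Suc d)
  then obtain x s' where s: "s = x # s'" "0 \<le> x" "x < k" "s' \<in> residue_vectors k d"
    by (auto simp: residue_vectors_def length_Suc_conv)
  have "fillable (1 + d) ((\<lambda>s. [x] @ s) ` {s'})"
    using s Suc.IH fillable_singleton_1
    by (intro axis_tileable_graph_left) (auto simp: residue_vectors_def)
  then show ?case using s by simp
qed

text \<open>Each new dimension adds \<open>k - 1\<close> holes: slice 0 keeps the old set and each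
  of the other \<open>k - 1\<close> slices gets a single hole.\<close>

lemma ex_fillable_card:
  "\<exists>d S. S \<subseteq> residue_vectors k d \<and> finite S \<and> card S = 1 + n * nat (k - 1) \<and> fillable d S"
proof (induction n)
  case 0
  have "fillable 0 {[]}"
    by (rule fillable_singleton) (simp add: residue_vectors_def)
  then show ?case
    by (intro exI[of _ 0] exI[of _ "{[]}"]) (simp add: residue_vectors_def)
next
  case (Suc n)
  then obtain d S where S: "S \<subseteq> residue_vectors k d" "finite S"
    "card S = 1 + n * nat (k - 1)" "fillable d S" by blast
  let ?z = "replicate d (0::int)"
  have z: "?z \<in> residue_vectors k d" using k by (auto simp: residue_vectors_def)
  define U where "U = (\<lambda>x::int. if x = 0 then S else {?z})"
  let ?S' = "\<Union>x\<in>{0..<k}. (#) x ` U x"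
  have "fillable (Suc d) ?S'"
    using k S(4) fillable_singleton[OF z]
    by (intro axis_tileable_slices) (auto simp: U_def)
  moreover have "?S' = (#) 0 ` S \<union> (\<lambda>x. x # ?z) ` {1..<k}"
  proof -
    have "{0..<k} = insert 0 {1..<k}" using k by auto
    moreover have "(\<Union>x\<in>{1..<k}. (#) x ` U x) = (\<Union>x\<in>{1..<k}. {x # ?z})"
      by (intro SUP_cong) (auto simp: U_def)
    ultimately show ?thesis
      by (simp only: UN_insert UNION_singleton_eq_range) (simp add: U_def)
  qed
  moreover have "card ((#) 0 ` S \<union> (\<lambda>x. x # ?z) ` {1..<k}) = card S + nat (k - 1)"
    using S(2) by (subst card_Un_disjoint) (auto simp: card_image inj_on_def)
  moreover have "(#) 0 ` S \<union> (\<lambda>x. x # ?z) ` {1..<k} \<subseteq> residue_vectors k (Suc d)"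
    using k S(1) z by (auto simp: residue_vectors_Cons)
  ultimately show ?case
    using S(2,3) by (intro exI[of _ "Suc d"] exI[of _ ?S']) auto
qed

text \<open>Induction on \<open>F\<close>: each new subset gets its own block of coordinates, placed
  in front, and the graph lemmas keep the earlier subsets fillable.\<close>

lemma ex_common_embedding:
  assumes "finite F" "finite P" "P \<subseteq> residue_vectors k m"
    and "\<And>S. S \<in> F \<Longrightarrow> S \<subseteq> P \<and> card S mod nat (k - 1) = 1"
  shows "\<exists>d \<phi>. inj_on \<phi> P \<and> \<phi> ` P \<subseteq> residue_vectors k d \<and> (\<forall>S\<in>F. fillable d (\<phi> ` S))"
  using assms(1,4)
proof (induction F rule: finite_induct)
  case empty
  show ?case
    using assms(3) by (intro exI[of _ m] exI[of _ id]) auto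
next
  case (insert S F)
  then obtain d \<phi> where \<phi>: "inj_on \<phi> P" "\<phi> ` P \<subseteq> residue_vectors k d"
    "\<And>S. S \<in> F \<Longrightarrow> fillable d (\<phi> ` S)"
    by (metis insertCI)
  have S: "S \<subseteq> P" "card S mod nat (k - 1) = 1"
    using insert.prems by auto
  have fin: "finite S" using S(1) assms(2) finite_subset by blast
  have "card S = 1 + card S div nat (k - 1) * nat (k - 1)"
    using S(2) by (metis add.commute div_mult_mod_eq)
  then obtain e G where G: "G \<subseteq> residue_vectors k e" "finite G" "card G = card S" "fillable e G"
    using ex_fillable_card by metis
  obtain g where g: "bij_betw g S G"
    using finite_same_card_bij[OF fin G(2)] G(3) by auto
  \<comment> \<open>Off \<open>S\<close> any residue vector would do, since injectivity of \<psi>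
    comes from \<phi>.\<close>
  define g' where "g' p = (if p \<in> S then g p else replicate e 0)" for p
  have g'_res: "g' p \<in> residue_vectors k e" for p
    using g G(1) k by (auto simp: g'_def residue_vectors_def bij_betw_def)
  define \<psi> where "\<psi> p = g' p @ \<phi> p" for p
  have \<phi>_res: "\<phi> p \<in> residue_vectors k d" if "p \<in> P" for p
    using \<phi>(2) that by blast
  have len: "length (g' p) = e" for p
    using g'_res by (auto simp: residue_vectors_def)
  have "inj_on \<psi> P"
    using \<phi>(1) len by (auto simp: inj_on_def \<psi>_def)
  moreover have "\<psi> ` P \<subseteq> residue_vectors k (e + d)"
    using g'_res \<phi>_res by (auto simp: \<psi>_def intro: residue_vectors_append)
  moreover have "fillable (e + d) (\<psi> ` S)"
  proof -
    have inv: "inv_into S g (g p) = p" if "p \<in> S" for p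
      using g that by (simp add: bij_betw_def)
    \<comment> \<open>The new image is a graph over the fillable model \<open>G\<close> of
      \<open>S\<close>, with the old embedding as the map.\<close>
    have "fillable (e + d) ((\<lambda>s. s @ \<phi> (inv_into S g s)) ` G)"
    proof (rule axis_tileable_graph_right[OF G(4)])
      fix s assume "s \<in> G"
      then have "inv_into S g s \<in> P"
        using g S(1) by (metis bij_betw_def inv_into_into subsetD)
      then have "\<phi> (inv_into S g s) \<in> residue_vectors k d" by (rule \<phi>_res)
      then show "fillable d {\<phi> (inv_into S g s)}" "length (\<phi> (inv_into S g s)) = d"
        using fillable_singleton by (auto simp: residue_vectors_def)
      show "length s = e" using G(1) \<open>s \<in> G\<close> by (auto simp: residue_vectors_def)
    qed
    also have "(\<lambda>s. s @ \<phi> (inv_into S g s)) ` G = \<psi> ` S"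
      using inv g by (force simp: bij_betw_def \<psi>_def g'_def)
    finally show ?thesis .
  qed
  moreover have "fillable (e + d) (\<psi> ` S')" if "S' \<in> F" for S'
  proof -
    have sub: "S' \<subseteq> P" using insert.prems that by auto
    have inv: "inv_into P \<phi> (\<phi> p) = p" if "p \<in> S'" for p
      using \<phi>(1) sub that by (auto intro: inv_into_f_f)
    \<comment> \<open>An old subset instead becomes a graph over its previous image, with the new
      block as the map.\<close>
    have "fillable (e + d) ((\<lambda>s. g' (inv_into P \<phi> s) @ s) ` (\<phi> ` S'))"
      using \<phi>_res sub
      by (intro axis_tileable_graph_left \<phi>(3) that fillable_singleton g'_res len)
        (auto simp: residue_vectors_def)
    also have "(\<lambda>s. g' (inv_into P \<phi> s) @ s) ` (\<phi> ` S') = \<psi> ` S'"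
      using inv by (force simp: \<psi>_def)
    finally show ?thesis .
  qed
  ultimately show ?case by blast
qed

section \<open>Weights and the copies in the first direction\<close>

text \<open>Started from k - 1 zeros; solved for the top entry of the window when going up and for the
  bottom entry when going down.\<close>

function weight :: "int \<Rightarrow> int" where
  "weight n =
    (if n < 0 then (1 - (\<Sum>t\<in>T - {k}. weight (n + k - t))) mod (k - 1)
     else if n < k - 1 then 0
     else (1 - (\<Sum>t\<in>T - {1}. weight (n + 1 - t))) mod (k - 1))"
  by pat_completeness auto
termination
  \<comment> \<open>A negative index calls larger negative ones or indices in 0..k-2; adding
    \<open>k\<close> ranks it above the latter. From \<open>k - 1\<close> on, calls go to smaller
    nonnegative indices.\<close>
  by (relation "measure (\<lambda>n. nat (if n < 0 then k - n else n))") (auto simp: T_def)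

declare weight.simps [simp del]

lemma weight_bounds: "0 \<le> weight n" "weight n < k - 1"
proof -
  have "0 \<le> weight n \<and> weight n < k - 1"
    using k unfolding weight.simps[of n] by (simp only: split: if_split) simp
  then show "0 \<le> weight n" "weight n < k - 1" by auto
qed

lemma finite_T: "finite T"
  by (simp add: T_def)

text \<open>Each sum is one instance of the recursion: at \<open>y - k\<close>, which is negative,
  when \<open>y < k\<close>, and at \<open>y - 1\<close>, which is at least \<open>k - 1\<close>,
  otherwise.\<close>

lemma weight_sum: "(\<Sum>t\<in>T. weight (y - t)) mod (k - 1) = 1"
proof -
  \<comment> \<open>Here \<open>k - 1\<close> is at least 2, so 1 is its own residue.\<close>
  have one: "((1 - b) mod (k - 1) + b) mod (k - 1) = 1" for b
    using k by (simp add: mod_add_left_eq)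
  show ?thesis
  proof (cases "y < k")
    case True
    have "k \<in> T" using k i by (auto simp: T_def)
    then have "(\<Sum>t\<in>T. weight (y - t)) = weight (y - k) + (\<Sum>t\<in>T - {k}. weight (y - t))"
      by (rule sum.remove[OF finite_T])
    moreover have "weight (y - k) = (1 - (\<Sum>t\<in>T - {k}. weight (y - t))) mod (k - 1)"
      using True by (subst weight.simps) simp
    ultimately show ?thesis using one by simp
  next
    case False
    have "1 \<in> T" using k i by (auto simp: T_def)
    then have "(\<Sum>t\<in>T. weight (y - t)) = weight (y - 1) + (\<Sum>t\<in>T - {1}. weight (y - t))"
      by (rule sum.remove[OF finite_T])
    moreover have "weight (y - 1) = (1 - (\<Sum>t\<in>T - {1}. weight (y - t))) mod (k - 1)"
      using False k by (subst weight.simps) simp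
    ultimately show ?thesis using one by simp
  qed
qed

text \<open>Over the point labelled [r, j] sit the translates a + T with a mod k = r and j < weight a;
  active y lists the labels whose column is covered at height y.\<close>

definition labels :: "int list set" where
  "labels = {[r, j] | r j. r \<in> {0..<k} \<and> j \<in> {0..<k - 1}}"

definition starts :: "int list \<Rightarrow> int set" where
  "starts p = {a. a mod k = p ! 0 \<and> p ! 1 < weight a}"

definition active :: "int \<Rightarrow> int list set" where
  "active y = {p \<in> labels. y \<in> (\<Union>a\<in>starts p. (+) a ` T)}"

lemma finite_labels: "finite labels"
proof -
  have "labels = (\<lambda>(r, j). [r, j]) ` ({0..<k} \<times> {0..<k - 1})"
    by (auto simp: labels_def)
  then show ?thesis by simp
qed

text \<open>A translate through height \<open>y\<close> starts at \<open>y - t\<close> for some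
  \<open>t\<close> in \<open>T\<close>, and this start accounts for \<open>weight (y - t)\<close>
  labels. Distinct \<open>t\<close> give distinct residues of \<open>y - t\<close>, so no label is
  counted twice and \<open>weight_sum\<close> applies.\<close>

lemma card_active: "card (active y) mod nat (k - 1) = 1"
proof -
  let ?D = "SIGMA t:T. {0..<weight (y - t)}"
  let ?f = "\<lambda>(t, j). [(y - t) mod k, j]"
  have inj: "s = t" if "s \<in> T" "t \<in> T" "(y - s) mod k = (y - t) mod k" for s t
  proof (rule ccontr)
    assume "s \<noteq> t"
    with that(3) have "(+) (y - s) ` T \<inter> (+) (y - t) ` T = {}"
      by (intro translates_disjoint) auto
    moreover have "y \<in> (+) (y - s) ` T" "y \<in> (+) (y - t) ` T"
      using that(1,2) by (auto simp: image_iff)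
    ultimately show False by blast
  qed
  have "active y = ?f ` ?D"
  proof (intro equalityI subsetI)
    fix p assume "p \<in> active y"
    then obtain r j a t where p: "p = [r, j]" "0 \<le> j" "a mod k = r" "j < weight a" "t \<in> T" "y = a + t"
      by (auto simp: active_def labels_def starts_def)
    then show "p \<in> ?f ` ?D"
      by (intro image_eqI[of _ _ "(t, j)"]) auto
  next
    fix p assume "p \<in> ?f ` ?D"
    then obtain t j where p: "p = [(y - t) mod k, j]" "t \<in> T" "0 \<le> j" "j < weight (y - t)"
      by auto
    moreover have "j < k - 1" using p(4) weight_bounds(2)[of "y - t"] by simp
    moreover have "y - t \<in> starts p" "y \<in> (+) (y - t) ` T"
      using p by (auto simp: starts_def image_iff)
    moreover have "p \<in> labels"
      using p \<open>j < k - 1\<close> k by (auto simp: labels_def)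
    ultimately show "p \<in> active y"
      unfolding active_def by blast
  qed
  moreover have "inj_on ?f ?D"
    using inj by (auto simp: inj_on_def)
  ultimately have "card (active y) = (\<Sum>t\<in>T. nat (weight (y - t)))"
    by (simp add: card_image card_SigmaI finite_T)
  then have "int (card (active y)) = (\<Sum>t\<in>T. weight (y - t))"
    using weight_bounds(1) by simp
  then have "int (card (active y) mod nat (k - 1)) = 1"
    using weight_sum[of y] k by (simp add: zmod_int)
  then show ?thesis by simp
qed

section \<open>Assembly of the tiling\<close>

lemma ex_axis_tileable_lattice: "\<exists>d. axis_tileable T (lattice (Suc d))"
proof -
  \<comment> \<open>Labels are encoded as lists so that they already lie in a torus, where the
    embedding lemma can start.\<close>
  have "labels \<subseteq> residue_vectors k 2"
    using k by (auto simp: labels_def residue_vectors_def)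
  \<comment> \<open>There are infinitely many heights but only finitely many active sets, so one
    embedding serves all slices.\<close>
  moreover have "finite (range active)"
    by (rule finite_subset[of _ "Pow labels"]) (auto simp: active_def finite_labels)
  moreover have "S \<subseteq> labels \<and> card S mod nat (k - 1) = 1" if "S \<in> range active" for S
    using that card_active by (auto simp: active_def)
  ultimately have "\<exists>d \<phi>. inj_on \<phi> labels \<and> \<phi> ` labels \<subseteq> residue_vectors k d
      \<and> (\<forall>S\<in>range active. fillable d (\<phi> ` S))"
    using finite_labels by (intro ex_common_embedding)
  then obtain d \<phi> where \<phi>: "inj_on \<phi> labels" "\<And>y. fillable d (\<phi> ` active y)"
    by auto
  let ?m = "map (\<lambda>y. y mod k)"
  let ?col = "\<lambda>p. \<Union>a\<in>starts p. (+) a ` T"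
  \<comment> \<open>\<open>?A\<close> fills each slice off its active points; \<open>?B\<close>
    consists of the columns of translates over all lattice points reducing to an embedded label.
    Injectivity of \<phi> recovers the label and hence the column.\<close>
  let ?A = "\<Union>y\<in>UNIV. (@) [y] ` avoiding k d (\<phi> ` active y)"
  let ?B = "\<Union>v\<in>{v \<in> lattice d. ?m v \<in> \<phi> ` labels}.
      (\<lambda>x. x @ v) ` (\<lambda>y. [y]) ` ?col (inv_into labels \<phi> (?m v))"
  have inv: "inv_into labels \<phi> (\<phi> p) = p" if "p \<in> labels" for p
    using \<phi>(1) that by simp
  have "axis_tileable T ?A"
    by (intro axis_tileable_UN axis_tileable_append_left \<phi>(2)) auto
  moreover have "axis_tileable T ?B"
    by (intro axis_tileable_UN axis_tileable_append_right axis_tileable_translates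
        translates_disjoint) (auto simp: starts_def)
  moreover have "?A \<inter> ?B = {}"
  proof -
    \<comment> \<open>The two parts are told apart by whether the tail reduces to a point active at
      the height given by the head.\<close>
    have A: "?m (tl x) \<notin> \<phi> ` active (hd x)" if "x \<in> ?A" for x
      using that by (auto simp: avoiding_def)
    have B: "?m (tl x) \<in> \<phi> ` active (hd x)" if "x \<in> ?B" for x
    proof -
      obtain v y where vy: "x = y # v" "?m v \<in> \<phi> ` labels" "y \<in> ?col (inv_into labels \<phi> (?m v))"
        using \<open>x \<in> ?B\<close> by fastforce
      then obtain p where p: "p \<in> labels" "?m v = \<phi> p" by blast
      with vy(3) have "p \<in> active y"
        by (simp add: inv active_def)
      with p(2) vy(1) show ?thesis by simp
    qed
    show ?thesis
    proof (rule equals0I)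
      fix x assume x: "x \<in> ?A \<inter> ?B"
      show False
        using A[OF IntD1[OF x]] B[OF IntD2[OF x]] by contradiction
    qed
  qed
  ultimately have "axis_tileable T (?A \<union> ?B)"
    by (rule axis_tileable_Un)
  also have "?A \<union> ?B = lattice (Suc d)"
  proof
    show "?A \<union> ?B \<subseteq> lattice (Suc d)"
      by (auto simp: avoiding_def lattice_def)
    show "lattice (Suc d) \<subseteq> ?A \<union> ?B"
    proof
      fix x assume "x \<in> lattice (Suc d)"
      then obtain y v where x: "x = y # v" "length v = d"
        by (auto simp: lattice_def length_Suc_conv)
      show "x \<in> ?A \<union> ?B"
      proof (cases "?m v \<in> \<phi> ` active y")
        case True
        then obtain p where p: "p \<in> labels" "?m v = \<phi> p" "y \<in> ?col p"
          unfolding active_def by blast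
        then have "y \<in> ?col (inv_into labels \<phi> (?m v))" by (simp add: inv)
        then have "x \<in> (\<lambda>x. x @ v) ` (\<lambda>y. [y]) ` ?col (inv_into labels \<phi> (?m v))"
          unfolding x(1) by (intro image_eqI[of _ _ "[y]"]) simp_all
        with p x(2) show ?thesis
          by (intro UnI2 UN_I[of v]) (auto simp: lattice_def)
      next
        case False
        with x show ?thesis
          by (intro UnI1 UN_I[of y]) (auto simp: avoiding_def lattice_def)
      qed
    qed
  qed
  finally show ?thesis by blast
qed

end

theorem theorem2:
  fixes k i :: int
  assumes "k \<ge> 3" and "2 \<le> i" and "i \<le> k - 1"
  shows "\<exists>d::nat. d \<ge> 1 \<and> tiles ({1..k} - {i}) d"
proof -
  interpret punctured_interval k i
    using assms by unfold_locales
  obtain d where "axis_tileable T (lattice (Suc d))"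
    using ex_axis_tileable_lattice by blast
  then have "tiles T (Suc d)"
    by (rule axis_tileable_imp_tiles)
  then show ?thesis
    unfolding T_def by (intro exI[of _ "Suc d"]) simp
qed

end
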